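(* Let $\Gamma$ be a set. The Banach space $\ell_1(\Gamma)$ endowed with its weak topology is an $\aleph$-space if and only if $|\Gamma|\le 2^{\aleph_0}$.
   Context: A family $\mathcal N$ of subsets of a topological space $Y$ is a $k$-network if whenever $K\subset U$ with $K$ compact and $U$ open in $Y$, there is a finite $\mathcal F\subset\mathcal N$ with $K\subset\bigcup\mathcal F\subset U$. A space is an $\aleph$-space if it is regular and has a $\sigma$-locally finite $k$-network. *)

theory Defs
  imports "HOL-Analysis.Analysis" "HOL-Library.Equipollence"
begin

definition k_network :: "'b topology \<Rightarrow> 'b set set \<Rightarrow> bool" where
  "k_network X \<N> \<longleftrightarrow> \<N> \<subseteq> Pow (topspace X) \<and>
     (\<forall>K U. compactin X K \<and> openin X U \<and> K \<subseteq> U \<longrightarrow>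
        (\<exists>\<F>. finite \<F> \<and> \<F> \<subseteq> \<N> \<and> K \<subseteq> \<Union>\<F> \<and> \<Union>\<F> \<subseteq> U))"

definition sigma_locally_finite :: "'b topology \<Rightarrow> 'b set set \<Rightarrow> bool" where
  "sigma_locally_finite X \<N> \<longleftrightarrow>
     (\<exists>N :: nat \<Rightarrow> 'b set set. (\<forall>n. locally_finite_in X (N n)) \<and> \<N> = (\<Union>n. N n))"

definition aleph_space :: "'b topology \<Rightarrow> bool" where
  "aleph_space X \<longleftrightarrow> regular_space X \<and>
     (\<exists>\<N>. sigma_locally_finite X \<N> \<and> k_network X \<N>)"

definition l1 :: "'a set \<Rightarrow> ('a \<Rightarrow> real) set" where
  "l1 \<Gamma> = {x. (\<forall>i. i \<notin> \<Gamma> \<longrightarrow> x i = 0) \<and> (\<lambda>i. \<bar>x i\<bar>) summable_on \<Gamma>}"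

definition l1_norm :: "'a set \<Rightarrow> ('a \<Rightarrow> real) \<Rightarrow> real" where
  "l1_norm \<Gamma> x = (\<Sum>\<^sub>\<infinity>i\<in>\<Gamma>. \<bar>x i\<bar>)"

definition l1_dual :: "'a set \<Rightarrow> (('a \<Rightarrow> real) \<Rightarrow> real) set" where
  "l1_dual \<Gamma> = {f.
     (\<forall>x\<in>l1 \<Gamma>. \<forall>y\<in>l1 \<Gamma>. f (\<lambda>i. x i + y i) = f x + f y) \<and>
     (\<forall>x\<in>l1 \<Gamma>. \<forall>c::real. f (\<lambda>i. c * x i) = c * f x) \<and>
     (\<forall>x\<in>l1 \<Gamma>. \<forall>e>0. \<exists>d>0. \<forall>y\<in>l1 \<Gamma>.
          l1_norm \<Gamma> (\<lambda>i. y i - x i) < d \<longrightarrow> \<bar>f y - f x\<bar> < e)}"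

definition l1_weak_topology :: "'a set \<Rightarrow> ('a \<Rightarrow> real) topology" where
  "l1_weak_topology \<Gamma> = topology_generated_by
     {{x \<in> l1 \<Gamma>. f x \<in> U} | f U. f \<in> l1_dual \<Gamma> \<and> open U}"

end

theory Submission
  imports Defs
begin

text \<open>
  Necessity: given a \<open>\<sigma>\<close>-locally finite network, \<open>0\<close> has for each of the countably many layers a
  neighbourhood meeting finitely many of its members, and all these neighbourhoods together are
  determined by countably many functionals. If these agree on the unit vectors \<open>e\<^sub>a\<close> and \<open>e\<^sub>b\<close>, then
  \<open>e\<^sub>a - e\<^sub>b\<close> lies in all of these neighbourhoods, and a member of the network isolating it from the
  other differences of unit vectors belongs to a countable family. So up to countably many indices,
  \<open>a\<close> is determined by a sequence of reals.

  Sufficiency: a gliding hump shows that weakly compact sets have uniformly small tails, so that on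
  them the weak and the norm topology coincide. It is therefore enough to find a \<open>\<sigma>\<close>-locally finite
  family of norm neighbourhoods that is fine enough. Embed \<open>\<Gamma>\<close> into the Cantor set and partition it
  at each level into countably many cells. Norm balls around finitely supported rational vectors
  with at most one support point per cell, restricted so that each such point dominates
  its cell, form such a family: the weakly continuous cell masses locate the support points up to
  finitely many choices.
\<close>

section \<open>The space of summable families and its weak topology\<close>

lemma l1_summable_on:
  assumes "x \<in> l1 \<Gamma>" "A \<subseteq> \<Gamma>"
  shows "(\<lambda>i. \<bar>x i\<bar>) summable_on A"
  using assms by (auto simp: l1_def intro: summable_on_subset_banach)

lemma l1_add:
  assumes "x \<in> l1 \<Gamma>" "y \<in> l1 \<Gamma>"
  shows "(\<lambda>i. x i + y i) \<in> l1 \<Gamma>"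
proof -
  have "(\<lambda>i. \<bar>x i\<bar> + \<bar>y i\<bar>) summable_on \<Gamma>"
    using assms by (intro summable_on_add l1_summable_on) auto
  then have "(\<lambda>i. \<bar>x i + y i\<bar>) summable_on \<Gamma>"
    by (rule summable_on_comparison_test) auto
  then show ?thesis using assms by (auto simp: l1_def)
qed

lemma l1_cmult:
  assumes "x \<in> l1 \<Gamma>"
  shows "(\<lambda>i. c * x i) \<in> l1 \<Gamma>"
  using assms by (auto simp: l1_def abs_mult intro: summable_on_cmult_right)

lemma l1_diff:
  assumes "x \<in> l1 \<Gamma>" "y \<in> l1 \<Gamma>"
  shows "(\<lambda>i. x i - y i) \<in> l1 \<Gamma>"
  using l1_add[OF assms(1) l1_cmult[OF assms(2), of "-1"]] by simp

lemma l1_finite_support: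
  assumes "finite {i. x i \<noteq> 0}" "{i. x i \<noteq> 0} \<subseteq> \<Gamma>"
  shows "x \<in> l1 \<Gamma>"
proof -
  have "(\<lambda>i. \<bar>x i\<bar>) summable_on \<Gamma> \<longleftrightarrow> (\<lambda>i. \<bar>x i\<bar>) summable_on {i. x i \<noteq> 0}"
    using assms(2) by (intro summable_on_cong_neutral) auto
  then show ?thesis using assms by (auto simp: l1_def)
qed

text \<open>For \<open>A \<subseteq> \<Gamma>\<close>, \<open>l1_norm A x\<close> serves as the mass
  of \<open>x\<close> on \<open>A\<close>; the estimates below compare such partial masses.\<close>

lemma l1_norm_mono:
  assumes "x \<in> l1 \<Gamma>" "A \<subseteq> B" "B \<subseteq> \<Gamma>"
  shows "l1_norm A x \<le> l1_norm B x"
  unfolding l1_norm_def using assms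
  by (intro infsum_mono2 l1_summable_on[OF assms(1)]) auto

lemma l1_norm_Un:
  assumes "x \<in> l1 \<Gamma>" "A \<subseteq> \<Gamma>" "B \<subseteq> \<Gamma>" "A \<inter> B = {}"
  shows "l1_norm (A \<union> B) x = l1_norm A x + l1_norm B x"
  unfolding l1_norm_def using assms
  by (intro infsum_Un_disjoint l1_summable_on[OF assms(1)]) auto

lemma l1_norm_triangle:
  assumes "x \<in> l1 \<Gamma>" "y \<in> l1 \<Gamma>" "z \<in> l1 \<Gamma>" "A \<subseteq> \<Gamma>"
  shows "l1_norm A (\<lambda>i. x i - z i) \<le> l1_norm A (\<lambda>i. x i - y i) + l1_norm A (\<lambda>i. y i - z i)"
proof -
  have s: "(\<lambda>i. \<bar>u i - v i\<bar>) summable_on A" if "u \<in> l1 \<Gamma>" "v \<in> l1 \<Gamma>" for u v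
    using l1_summable_on[OF l1_diff[OF that] assms(4)] by simp
  show ?thesis unfolding l1_norm_def
    by (subst infsum_add[symmetric])
       (auto intro!: infsum_mono summable_on_add s assms)
qed

lemma l1_norm_diff_le:
  assumes "x \<in> l1 \<Gamma>" "y \<in> l1 \<Gamma>" "A \<subseteq> \<Gamma>"
  shows "l1_norm A (\<lambda>i. x i - y i) \<le> l1_norm A x + l1_norm A y"
  using l1_norm_triangle[OF assms(1) l1_finite_support assms(2,3), of "\<lambda>_. 0"]
  by (simp add: l1_norm_def)

lemma l1_norm_le_diff:
  assumes "x \<in> l1 \<Gamma>" "y \<in> l1 \<Gamma>" "A \<subseteq> \<Gamma>"
  shows "l1_norm A x \<le> l1_norm A (\<lambda>i. x i - y i) + l1_norm A y"
  using l1_norm_triangle[OF assms(1,2) l1_finite_support assms(3), of "\<lambda>_. 0"]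
  by (simp add: l1_norm_def)

lemma l1_norm_minus_commute:
  "l1_norm A (\<lambda>i. x i - y i) = l1_norm A (\<lambda>i. y i - x i)"
  by (simp add: l1_norm_def abs_minus_commute)

lemma l1_tail:
  assumes "x \<in> l1 \<Gamma>" "e > 0"
  obtains F where "finite F" "F \<subseteq> \<Gamma>" "l1_norm (\<Gamma> - F) x < e"
proof -
  obtain F where F: "finite F" "F \<subseteq> \<Gamma>"
    "dist (sum (\<lambda>i. \<bar>x i\<bar>) F) (infsum (\<lambda>i. \<bar>x i\<bar>) \<Gamma>) \<le> e/2"
    using infsum_finite_approximation[of "\<lambda>i. \<bar>x i\<bar>" \<Gamma> "e/2"] assms
    by (auto intro: l1_summable_on)
  have "l1_norm \<Gamma> x = l1_norm F x + l1_norm (\<Gamma> - F) x"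
    using l1_norm_Un[OF assms(1) F(2), of "\<Gamma> - F"] F(2) by (simp add: Un_absorb1)
  then have "l1_norm (\<Gamma> - F) x < e"
    using F assms(2) by (auto simp: l1_norm_def dist_real_def)
  with F that show thesis by blast
qed

section \<open>Functionals given by bounded coefficients\<close>

text \<open>The functional represented by a bounded function \<phi>. Where a bound is needed, it is
  normalised to modulus at most 1.\<close>

definition l1_pair :: "'a set \<Rightarrow> ('a \<Rightarrow> real) \<Rightarrow> ('a \<Rightarrow> real) \<Rightarrow> real" where
  "l1_pair \<Gamma> \<phi> x = (\<Sum>\<^sub>\<infinity>i\<in>\<Gamma>. \<phi> i * x i)"

lemma l1_pair_summable_on:
  assumes "x \<in> l1 \<Gamma>" "\<And>i. \<bar>\<phi> i\<bar> \<le> 1" "A \<subseteq> \<Gamma>"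
  shows "(\<lambda>i. \<phi> i * x i) summable_on A" "(\<lambda>i. \<bar>\<phi> i * x i\<bar>) summable_on A"
proof -
  show *: "(\<lambda>i. \<bar>\<phi> i * x i\<bar>) summable_on A"
    using l1_summable_on[OF assms(1,3)]
    by (rule summable_on_comparison_test) (auto simp: abs_mult intro!: mult_left_le_one_le assms)
  show "(\<lambda>i. \<phi> i * x i) summable_on A"
    using * abs_summable_summable[of "\<lambda>i. \<phi> i * x i" A] by simp
qed

lemma l1_pair_abs_le:
  assumes "x \<in> l1 \<Gamma>" "\<And>i. \<bar>\<phi> i\<bar> \<le> 1" "A \<subseteq> \<Gamma>" "\<And>i. i \<in> \<Gamma> - A \<Longrightarrow> \<phi> i = 0"
  shows "\<bar>l1_pair \<Gamma> \<phi> x\<bar> \<le> l1_norm A x"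
proof -
  have "l1_pair \<Gamma> \<phi> x = infsum (\<lambda>i. \<phi> i * x i) A"
    unfolding l1_pair_def using assms by (intro infsum_cong_neutral) auto
  then have "\<bar>l1_pair \<Gamma> \<phi> x\<bar> \<le> infsum (\<lambda>i. \<bar>\<phi> i * x i\<bar>) A"
    using norm_infsum_bound[of "\<lambda>i. \<phi> i * x i" A] l1_pair_summable_on[of x \<Gamma> \<phi> A] assms by simp
  also have "\<dots> \<le> l1_norm A x"
    unfolding l1_norm_def using assms
    by (intro infsum_mono l1_pair_summable_on l1_summable_on)
       (auto simp: abs_mult intro!: mult_left_le_one_le assms)
  finally show ?thesis .
qed

text \<open>Matching signs collect the full mass on \<open>A\<close>, while coefficients of modulus
  at most 1 lose at most the mass on \<open>B\<close>. This gives the lower bound for the gliding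
  hump.\<close>

lemma l1_pair_ge:
  assumes "x \<in> l1 \<Gamma>" "\<And>i. \<bar>\<phi> i\<bar> \<le> 1" "A \<subseteq> \<Gamma>" "B \<subseteq> \<Gamma>" "A \<inter> B = {}"
    and sign: "\<And>i. i \<in> A \<Longrightarrow> \<phi> i * x i = \<bar>x i\<bar>"
    and zero: "\<And>i. i \<in> \<Gamma> - (A \<union> B) \<Longrightarrow> \<phi> i = 0"
  shows "l1_norm A x - l1_norm B x \<le> l1_pair \<Gamma> \<phi> x"
proof -
  have "l1_pair \<Gamma> \<phi> x = infsum (\<lambda>i. \<phi> i * x i) (A \<union> B)"
    unfolding l1_pair_def using assms by (intro infsum_cong_neutral) auto
  also have "\<dots> = infsum (\<lambda>i. \<phi> i * x i) A + infsum (\<lambda>i. \<phi> i * x i) B"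
    using assms by (intro infsum_Un_disjoint l1_pair_summable_on) auto
  also have "infsum (\<lambda>i. \<phi> i * x i) A = l1_norm A x"
    unfolding l1_norm_def using sign by (rule infsum_cong)
  finally have 1: "l1_pair \<Gamma> \<phi> x = l1_norm A x + infsum (\<lambda>i. \<phi> i * x i) B" .
  have "\<bar>infsum (\<lambda>i. \<phi> i * x i) B\<bar> \<le> infsum (\<lambda>i. \<bar>\<phi> i * x i\<bar>) B"
    using norm_infsum_bound[of "\<lambda>i. \<phi> i * x i" B] l1_pair_summable_on[of x \<Gamma> \<phi> B] assms by simp
  also have "\<dots> \<le> l1_norm B x"
    unfolding l1_norm_def using assms
    by (intro infsum_mono l1_pair_summable_on l1_summable_on)
       (auto simp: abs_mult intro!: mult_left_le_one_le assms)
  finally show ?thesis using 1 by linarith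
qed

lemma l1_pair_diff:
  assumes "x \<in> l1 \<Gamma>" "y \<in> l1 \<Gamma>" "\<And>i. \<bar>\<phi> i\<bar> \<le> 1"
  shows "l1_pair \<Gamma> \<phi> (\<lambda>i. x i - y i) = l1_pair \<Gamma> \<phi> x - l1_pair \<Gamma> \<phi> y"
proof -
  have "l1_pair \<Gamma> \<phi> x = infsum (\<lambda>i. \<phi> i * (x i - y i) + \<phi> i * y i) \<Gamma>"
    by (simp add: l1_pair_def algebra_simps)
  also have "\<dots> = l1_pair \<Gamma> \<phi> (\<lambda>i. x i - y i) + l1_pair \<Gamma> \<phi> y"
    unfolding l1_pair_def using assms
    by (intro infsum_add l1_pair_summable_on[OF l1_diff] l1_pair_summable_on) auto
  finally show ?thesis by simp
qed

lemma l1_pair_in_dual: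
  assumes "\<And>i. \<bar>\<phi> i\<bar> \<le> 1"
  shows "l1_pair \<Gamma> \<phi> \<in> l1_dual \<Gamma>"
proof -
  have "l1_pair \<Gamma> \<phi> (\<lambda>i. x i + y i) = l1_pair \<Gamma> \<phi> x + l1_pair \<Gamma> \<phi> y"
    if "x \<in> l1 \<Gamma>" "y \<in> l1 \<Gamma>" for x y
    using l1_pair_diff[OF l1_add[OF that] that(2), of \<phi>] assms by simp
  moreover have "l1_pair \<Gamma> \<phi> (\<lambda>i. c * x i) = c * l1_pair \<Gamma> \<phi> x" for x c
    by (simp add: l1_pair_def infsum_cmult_right'[symmetric] mult.left_commute)
  moreover have "\<bar>l1_pair \<Gamma> \<phi> y - l1_pair \<Gamma> \<phi> x\<bar> \<le> l1_norm \<Gamma> (\<lambda>i. y i - x i)"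
    if "x \<in> l1 \<Gamma>" "y \<in> l1 \<Gamma>" for x y
    using l1_pair_abs_le[OF l1_diff[OF that(2,1)], of \<phi> \<Gamma>] assms
    by (simp add: l1_pair_diff[OF that(2,1)])
  ultimately show ?thesis
    unfolding l1_dual_def
    by (intro CollectI conjI ballI allI impI) (blast, blast, meson le_less_trans)
qed

lemma l1_pair_coordinate:
  assumes "x \<in> l1 \<Gamma>"
  shows "l1_pair \<Gamma> (indicator {i}) x = x i"
proof (cases "i \<in> \<Gamma>")
  case True
  then have "l1_pair \<Gamma> (indicator {i}) x = infsum x {i}"
    unfolding l1_pair_def by (intro infsum_cong_neutral) (auto simp: indicator_def)
  then show ?thesis by simp
next
  case False
  then have "l1_pair \<Gamma> (indicator {i}) x = infsum (\<lambda>_. 0) \<Gamma>"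
    unfolding l1_pair_def by (intro infsum_cong) (auto simp: indicator_def)
  with False assms show ?thesis by (simp add: l1_def)
qed

lemma l1_coordinate_in_dual:
  "l1_pair \<Gamma> (indicator {i}) \<in> l1_dual \<Gamma>"
  by (intro l1_pair_in_dual) (auto simp: indicator_def)

lemma l1_dual_diff:
  assumes "f \<in> l1_dual \<Gamma>" "x \<in> l1 \<Gamma>" "y \<in> l1 \<Gamma>"
  shows "f (\<lambda>i. x i - y i) = f x - f y"
proof -
  have "f (\<lambda>i. x i - y i + y i) = f (\<lambda>i. x i - y i) + f y"
    using assms(1) unfolding l1_dual_def
    by (elim CollectE conjE) (erule bspec[OF bspec[OF _ l1_diff[OF assms(2,3)]] assms(3)])
  then show ?thesis by simp
qed

section \<open>Neighbourhoods and regularity of the weak topology\<close>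

lemma topspace_l1_weak [simp]: "topspace (l1_weak_topology \<Gamma>) = l1 \<Gamma>"
proof -
  \<comment> \<open>The zero functional with \<open>U = UNIV\<close> exhibits all of
    \<open>l1 \<Gamma>\<close> as a generating set.\<close>
  have "l1_pair \<Gamma> (\<lambda>_. 0) \<in> l1_dual \<Gamma>" by (rule l1_pair_in_dual) auto
  then show ?thesis
    unfolding l1_weak_topology_def topology_generated_by_topspace
    by (auto intro!: exI[of _ "l1 \<Gamma>"] exI[of _ "l1_pair \<Gamma> (\<lambda>_. 0)"] exI[of _ UNIV])
qed

lemma openin_l1_weak_preimage:
  assumes "f \<in> l1_dual \<Gamma>" "open U"
  shows "openin (l1_weak_topology \<Gamma>) {x \<in> l1 \<Gamma>. f x \<in> U}"
  unfolding l1_weak_topology_def using assms by (intro topology_generated_by_Basis) blast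

lemma closedin_l1_weak_preimage:
  assumes "f \<in> l1_dual \<Gamma>" "closed C"
  shows "closedin (l1_weak_topology \<Gamma>) {x \<in> l1 \<Gamma>. f x \<in> C}"
proof -
  have "l1 \<Gamma> - {x \<in> l1 \<Gamma>. f x \<in> C} = {x \<in> l1 \<Gamma>. f x \<in> - C}" by auto
  then show ?thesis
    using openin_l1_weak_preimage[OF assms(1), of "- C"] assms(2)
    by (auto simp: closedin_def)
qed

definition l1_weak_nbhd ::
    "'a set \<Rightarrow> (('a \<Rightarrow> real) \<Rightarrow> real) set \<Rightarrow> ('a \<Rightarrow> real) \<Rightarrow> real \<Rightarrow> ('a \<Rightarrow> real) set" where
  "l1_weak_nbhd \<Gamma> \<Phi> x e = {y \<in> l1 \<Gamma>. \<forall>f\<in>\<Phi>. \<bar>f y - f x\<bar> < e}"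

lemma openin_l1_weak_nbhd:
  assumes "finite \<Phi>" "\<Phi> \<subseteq> l1_dual \<Gamma>"
  shows "openin (l1_weak_topology \<Gamma>) (l1_weak_nbhd \<Gamma> \<Phi> x e)"
  using assms
proof (induction \<Phi>)
  case empty
  then show ?case using openin_topspace[of "l1_weak_topology \<Gamma>"] by (simp add: l1_weak_nbhd_def)
next
  case (insert f \<Phi>)
  have "l1_weak_nbhd \<Gamma> (insert f \<Phi>) x e = {y \<in> l1 \<Gamma>. f y \<in> ball (f x) e} \<inter> l1_weak_nbhd \<Gamma> \<Phi> x e"
    by (auto simp: l1_weak_nbhd_def dist_real_def abs_minus_commute)
  moreover have "openin (l1_weak_topology \<Gamma>) {y \<in> l1 \<Gamma>. f y \<in> ball (f x) e}"
    using insert.prems by (intro openin_l1_weak_preimage) auto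
  ultimately show ?case using insert by (simp add: openin_Int)
qed

text \<open>Induction over the generation of the topology: an intersection merges the two sets of
  functionals and takes the smaller radius, a union inherits from one of its members.\<close>

lemma l1_weak_nbhd_base:
  assumes "openin (l1_weak_topology \<Gamma>) U" "x \<in> U"
  obtains \<Phi> e where "finite \<Phi>" "\<Phi> \<subseteq> l1_dual \<Gamma>" "e > 0" "l1_weak_nbhd \<Gamma> \<Phi> x e \<subseteq> U"
proof -
  have "generate_topology_on {{x \<in> l1 \<Gamma>. f x \<in> U} | f U. f \<in> l1_dual \<Gamma> \<and> open U} U"
    using assms(1) unfolding l1_weak_topology_def by (rule openin_topology_generated_by)
  then have "\<exists>\<Phi> e. finite \<Phi> \<and> \<Phi> \<subseteq> l1_dual \<Gamma> \<and> e > 0 \<and> l1_weak_nbhd \<Gamma> \<Phi> x e \<subseteq> U"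
    using assms(2)
  proof (induction rule: generate_topology_on.induct)
    case Empty
    then show ?case by simp
  next
    case (Int a b)
    then obtain \<Phi> d \<Psi> e where
      "finite \<Phi>" "\<Phi> \<subseteq> l1_dual \<Gamma>" "d > 0" "l1_weak_nbhd \<Gamma> \<Phi> x d \<subseteq> a"
      "finite \<Psi>" "\<Psi> \<subseteq> l1_dual \<Gamma>" "e > 0" "l1_weak_nbhd \<Gamma> \<Psi> x e \<subseteq> b"
      by blast
    then show ?case
      by (intro exI[of _ "\<Phi> \<union> \<Psi>"] exI[of _ "min d e"]) (auto simp: l1_weak_nbhd_def subset_iff)
  next
    case (UN K)
    then show ?case by (meson UnionE Union_upper order_trans)
  next
    case (Basis s)
    then obtain f V where s: "s = {x \<in> l1 \<Gamma>. f x \<in> V}" "f \<in> l1_dual \<Gamma>" "open V" by blast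
    with Basis obtain e where "e > 0" "ball (f x) e \<subseteq> V" by (auto simp: open_contains_ball)
    with s show ?case
      by (intro exI[of _ "{f}"] exI[of _ e])
         (auto simp: l1_weak_nbhd_def subset_iff dist_real_def abs_minus_commute)
  qed
  then show thesis using that by blast
qed

text \<open>The closed neighbourhood of tolerance \<open>e/2\<close> lies between the open ones of
  tolerances \<open>e/2\<close> and \<open>e\<close>, so closed neighbourhoods form a base.\<close>

lemma regular_space_l1_weak: "regular_space (l1_weak_topology \<Gamma>)"
proof -
  let ?X = "l1_weak_topology \<Gamma>"
  have "\<exists>U V. openin ?X U \<and> closedin ?X V \<and> x \<in> U \<and> U \<subseteq> V \<and> V \<subseteq> W"
    if W: "openin ?X W" "x \<in> W" for W x
  proof -
    obtain \<Phi> e where \<Phi>: "finite \<Phi>" "\<Phi> \<subseteq> l1_dual \<Gamma>" "e > 0" "l1_weak_nbhd \<Gamma> \<Phi> x e \<subseteq> W"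
      using l1_weak_nbhd_base[OF W] .
    have x: "x \<in> l1 \<Gamma>" using W openin_subset by fastforce
    \<comment> \<open>The factor \<open>l1 \<Gamma>\<close> matters for empty \<Phi>, where the
      indexed intersection is \<open>UNIV\<close>.\<close>
    let ?V = "l1 \<Gamma> \<inter> (\<Inter>f\<in>\<Phi>. {y \<in> l1 \<Gamma>. f y \<in> cball (f x) (e/2)})"
    have "closedin ?X (\<Inter> (insert (l1 \<Gamma>) ((\<lambda>f. {y \<in> l1 \<Gamma>. f y \<in> cball (f x) (e/2)}) ` \<Phi>)))"
      using \<Phi> closedin_topspace[of ?X]
      by (intro closedin_Inter) (auto intro!: closedin_l1_weak_preimage simp del: mem_cball)
    then have "closedin ?X ?V" by simp
    moreover have "l1_weak_nbhd \<Gamma> \<Phi> x (e/2) \<subseteq> ?V"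
      by (auto simp: l1_weak_nbhd_def dist_real_def abs_minus_commute less_imp_le)
    moreover have "?V \<subseteq> l1_weak_nbhd \<Gamma> \<Phi> x e"
      using \<Phi>(3) by (force simp: l1_weak_nbhd_def dist_real_def abs_minus_commute)
    moreover have "x \<in> l1_weak_nbhd \<Gamma> \<Phi> x (e/2)"
      using x \<Phi>(3) by (auto simp: l1_weak_nbhd_def)
    ultimately show ?thesis
      using openin_l1_weak_nbhd[OF \<Phi>(1,2)] \<Phi>(4) by (meson order_trans)
  qed
  then show ?thesis
    unfolding neighbourhood_base_of_closedin[symmetric] neighbourhood_base_of by blast
qed

text \<open>A basic weak neighbourhood involves finitely many norm continuous functionals, so the
  least of their radii at \<open>x\<close> works.\<close>

lemma l1_weak_open_imp_norm_open:
  assumes "openin (l1_weak_topology \<Gamma>) U" "x \<in> U"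
  obtains r where "r > 0" "\<And>y. y \<in> l1 \<Gamma> \<Longrightarrow> l1_norm \<Gamma> (\<lambda>i. y i - x i) < r \<Longrightarrow> y \<in> U"
proof -
  obtain \<Phi> e where \<Phi>: "finite \<Phi>" "\<Phi> \<subseteq> l1_dual \<Gamma>" "e > 0" "l1_weak_nbhd \<Gamma> \<Phi> x e \<subseteq> U"
    using l1_weak_nbhd_base[OF assms] .
  have x: "x \<in> l1 \<Gamma>" using assms openin_subset by fastforce
  have "\<exists>r>0. \<forall>f\<in>\<Phi>. \<forall>y\<in>l1 \<Gamma>. l1_norm \<Gamma> (\<lambda>i. y i - x i) < r \<longrightarrow> \<bar>f y - f x\<bar> < e"
    using \<Phi>(1,2)
  proof (induction \<Phi>)
    case empty
    then show ?case by (auto intro: exI[of _ 1])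
  next
    case (insert f \<Phi>)
    then obtain r where r: "r>0"
      "\<forall>f\<in>\<Phi>. \<forall>y\<in>l1 \<Gamma>. l1_norm \<Gamma> (\<lambda>i. y i - x i) < r \<longrightarrow> \<bar>f y - f x\<bar> < e" by auto
    have "f \<in> l1_dual \<Gamma>" using insert by auto
    then obtain d where "d>0" "\<forall>y\<in>l1 \<Gamma>. l1_norm \<Gamma> (\<lambda>i. y i - x i) < d \<longrightarrow> \<bar>f y - f x\<bar> < e"
      using x \<Phi>(3) unfolding l1_dual_def by blast
    with r show ?case by (intro exI[of _ "min r d"]) auto
  qed
  then show thesis using \<Phi>(4) that unfolding l1_weak_nbhd_def by blast
qed

lemma l1_weak_nbhd_coordinates:
  assumes x: "x \<in> l1 \<Gamma>" and F: "finite F" "F \<subseteq> \<Gamma>" and d: "d > 0"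
  obtains V where "openin (l1_weak_topology \<Gamma>) V" "x \<in> V"
    "\<forall>y\<in>V. l1_norm F (\<lambda>i. y i - x i) < d"
proof -
  let ?\<Phi> = "(\<lambda>i. l1_pair \<Gamma> (indicator {i})) ` F"
  \<comment> \<open>The extra 1 keeps the sum of \<open>card F\<close> such terms strictly below
    \<open>d\<close> and covers empty \<open>F\<close>.\<close>
  let ?d = "d / (1 + real (card F))"
  let ?V = "l1_weak_nbhd \<Gamma> ?\<Phi> x ?d"
  show thesis
  proof (rule that[OF _ _ ballI])
    show "openin (l1_weak_topology \<Gamma>) ?V"
      using F by (intro openin_l1_weak_nbhd) (auto intro: l1_coordinate_in_dual)
    show "x \<in> ?V"
      using x d by (auto simp: l1_weak_nbhd_def intro!: divide_pos_pos)
    fix y assume y: "y \<in> ?V"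
    have "l1_norm F (\<lambda>i. y i - x i) = (\<Sum>i\<in>F. \<bar>y i - x i\<bar>)"
      using F by (simp add: l1_norm_def)
    also have "\<dots> \<le> (\<Sum>i\<in>F. ?d)"
      using y x by (intro sum_mono) (auto simp: l1_weak_nbhd_def l1_pair_coordinate less_imp_le)
    also have "\<dots> = real (card F) * d / (1 + real (card F))" by simp
    also have "\<dots> < d" using d by (simp add: divide_simps)
    finally show "l1_norm F (\<lambda>i. y i - x i) < d" .
  qed
qed

section \<open>The cardinality bound\<close>

text \<open>The code \<open>S a\<close> consists of the rational cuts of all values
  \<open>v f a\<close>, plus a private label if \<open>a\<close> occurs in an ambiguous pair.
  Countability of \<Phi> and of the set of these pairs makes the numberings injective.\<close>

lemma lepoll_nat_sets_if_countable_ambiguity: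
  fixes v :: "'f \<Rightarrow> 'a \<Rightarrow> real"
  assumes "countable \<Phi>"
    and "countable {(a, b). a \<in> \<Gamma> \<and> b \<in> \<Gamma> \<and> a \<noteq> b \<and> (\<forall>f\<in>\<Phi>. v f a = v f b)}"
      (is "countable ?E")
  shows "\<Gamma> \<lesssim> (UNIV :: nat set set)"
proof -
  define A where "A = fst ` ?E"
  have A: "countable A" unfolding A_def using assms(2) by (rule countable_image)
  define S :: "'a \<Rightarrow> (nat \<times> rat + nat) set" where
    "S a = {Inl (to_nat_on \<Phi> f, q) | f q. f \<in> \<Phi> \<and> v f a < of_rat q}
        \<union> (if a \<in> A then {Inr (to_nat_on A a)} else {})" for a
  \<comment> \<open>A rational strictly between the two values would lie in only one of the cuts.
    Equality follows by exchanging \<open>a\<close> and \<open>b\<close>.\<close>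
  have le: "v f b \<le> v f a" if "S a = S b" "f \<in> \<Phi>" for a b f
  proof (rule ccontr)
    assume "\<not> ?thesis"
    then obtain q where q: "v f a < of_rat q" "of_rat q < v f b"
      using of_rat_dense[of "v f a" "v f b"] by auto
    then have "Inl (to_nat_on \<Phi> f, q) \<in> S a" using that(2) by (auto simp: S_def)
    then have "Inl (to_nat_on \<Phi> f, q) \<in> S b" using that(1) by simp
    then obtain g where "g \<in> \<Phi>" "to_nat_on \<Phi> f = to_nat_on \<Phi> g" "v g b < of_rat q"
      by (auto simp: S_def split: if_splits)
    with q that assms(1) show False by simp
  qed
  have "inj_on S \<Gamma>"
  proof (rule inj_onI, rule ccontr)
    fix a b assume ab: "a \<in> \<Gamma>" "b \<in> \<Gamma>" "S a = S b" "a \<noteq> b"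
    have "\<forall>f\<in>\<Phi>. v f a = v f b"
      using le[OF ab(3)] le[OF ab(3)[symmetric]] by (auto intro: antisym)
    with ab have "(a, b) \<in> ?E" by simp
    then have "a \<in> A" unfolding A_def by force
    then have "Inr (to_nat_on A a) \<in> S b" using ab(3)[symmetric] by (simp add: S_def)
    then have "b \<in> A" "to_nat_on A a = to_nat_on A b" by (auto simp: S_def split: if_splits)
    with \<open>a \<in> A\<close> A ab(4) show False by simp
  qed
  then have "inj_on (\<lambda>a. to_nat ` S a) \<Gamma>"
    by (auto simp: inj_on_def inj_image_eq_iff)
  then show ?thesis unfolding lepoll_def by blast
qed

text \<open>A singleton is compact, and some member of its finite cover contains the point.\<close>

lemma k_network_imp_network:
  assumes "k_network X \<N>" "openin X U" "x \<in> U"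
  obtains N where "N \<in> \<N>" "x \<in> N" "N \<subseteq> U"
proof -
  have "x \<in> topspace X" using assms openin_subset by blast
  then obtain \<F> where "finite \<F>" "\<F> \<subseteq> \<N>" "{x} \<subseteq> \<Union>\<F>" "\<Union>\<F> \<subseteq> U"
    using assms unfolding k_network_def by (meson compactin_sing empty_subsetI insert_subset)
  then show thesis using that by blast
qed

lemma lepoll_if_sigma_locally_finite_network:
  assumes "sigma_locally_finite (l1_weak_topology \<Gamma>) \<N>"
    and network: "\<And>U x. openin (l1_weak_topology \<Gamma>) U \<Longrightarrow> x \<in> U \<Longrightarrow> \<exists>N\<in>\<N>. x \<in> N \<and> N \<subseteq> U"
  shows "\<Gamma> \<lesssim> (UNIV :: nat set set)"
proof -
  let ?X = "l1_weak_topology \<Gamma>"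
  define e :: "'a \<Rightarrow> 'a \<Rightarrow> real" where "e a = indicator {a}" for a
  define p where "p a b i = e a i - e b i" for a b i
  have "{i. e a i \<noteq> 0} = {a}" for a by (auto simp: e_def indicator_def)
  then have e: "e a \<in> l1 \<Gamma>" if "a \<in> \<Gamma>" for a using that by (intro l1_finite_support) auto
  then have p: "p a b \<in> l1 \<Gamma>" if "a \<in> \<Gamma>" "b \<in> \<Gamma>" for a b
    unfolding p_def using that by (intro l1_diff) auto
  have 0: "(\<lambda>_. 0) \<in> l1 \<Gamma>" by (simp add: l1_def)
  obtain M where M: "\<And>n. locally_finite_in ?X (M n)" "\<N> = (\<Union>n::nat. M n)"
    using assms(1) unfolding sigma_locally_finite_def by blast
  have "\<exists>V. openin ?X V \<and> (\<lambda>_. 0) \<in> V \<and> finite {N \<in> M n. N \<inter> V \<noteq> {}}" for n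
    using M(1)[of n] 0 unfolding locally_finite_in_def by auto
  from choice[OF allI[OF this]] obtain V where
    "\<forall>n. openin ?X (V n) \<and> (\<lambda>_. 0) \<in> V n \<and> finite {N \<in> M n. N \<inter> V n \<noteq> {}}" ..
  then have V: "openin ?X (V n)" "(\<lambda>_. 0) \<in> V n" "finite {N \<in> M n. N \<inter> V n \<noteq> {}}" for n
    by simp_all
  have "\<exists>\<Phi> d. finite \<Phi> \<and> \<Phi> \<subseteq> l1_dual \<Gamma> \<and> d > 0 \<and> l1_weak_nbhd \<Gamma> \<Phi> (\<lambda>_. 0) d \<subseteq> V n" for n
    by (rule l1_weak_nbhd_base[OF V(1,2)[of n]]) blast
  from choice[OF allI[OF this]] obtain \<Phi> where
    "\<forall>n. \<exists>d. finite (\<Phi> n) \<and> \<Phi> n \<subseteq> l1_dual \<Gamma> \<and> d > 0 \<and> l1_weak_nbhd \<Gamma> (\<Phi> n) (\<lambda>_. 0) d \<subseteq> V n" ..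
  from choice[OF this] obtain d where
    "\<forall>n. finite (\<Phi> n) \<and> \<Phi> n \<subseteq> l1_dual \<Gamma> \<and> d n > 0 \<and>
      l1_weak_nbhd \<Gamma> (\<Phi> n) (\<lambda>_. 0) (d n) \<subseteq> V n" ..
  then have \<Phi>: "finite (\<Phi> n)" "\<Phi> n \<subseteq> l1_dual \<Gamma>" "d n > 0"
    "l1_weak_nbhd \<Gamma> (\<Phi> n) (\<lambda>_. 0) (d n) \<subseteq> V n" for n by simp_all
  \<comment> \<open>The pairs whose unit vectors are not separated by any of the countably many
    functionals; the aim is to show that there are only countably many.\<close>
  let ?E = "{(a, b). a \<in> \<Gamma> \<and> b \<in> \<Gamma> \<and> a \<noteq> b \<and> (\<forall>f\<in>(\<Union>n. \<Phi> n). f (e a) = f (e b))}"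
  have pV: "p a b \<in> V n" if ab: "(a, b) \<in> ?E" for a b n
  proof -
    have "\<bar>f (p a b) - f (\<lambda>_. 0)\<bar> < d n" if "f \<in> \<Phi> n" for f
    proof -
      have f: "f \<in> l1_dual \<Gamma>" using that \<Phi>(2) by blast
      have "f (e a) = f (e b)" using ab that by blast
      then show ?thesis
        using l1_dual_diff[OF f e e, of a b] l1_dual_diff[OF f 0 0] ab
        \<Phi>(3) by (simp add: p_def[abs_def])
    qed
    then have "p a b \<in> l1_weak_nbhd \<Gamma> (\<Phi> n) (\<lambda>_. 0) (d n)"
      using ab p by (simp add: l1_weak_nbhd_def)
    then show ?thesis using \<Phi>(4) by blast
  qed
  \<comment> \<open>\<open>p a b\<close> is 1 at \<open>a\<close> and -1 at \<open>b\<close>, so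
    tolerance 1/2 in these two coordinates preserves signs.\<close>
  have isolate: "\<exists>N. N \<in> \<N> \<and> p a b \<in> N \<and> (\<forall>y\<in>N. y a > 1/2 \<and> y b < -1/2)"
    if ab: "(a, b) \<in> ?E" for a b
  proof -
    let ?\<Psi> = "{l1_pair \<Gamma> (indicator {a}), l1_pair \<Gamma> (indicator {b})}"
    let ?U = "l1_weak_nbhd \<Gamma> ?\<Psi> (p a b) (1/2)"
    have pl: "p a b \<in> l1 \<Gamma>" using p ab by auto
    have "openin ?X ?U" by (rule openin_l1_weak_nbhd) (auto simp: l1_coordinate_in_dual)
    moreover have "p a b \<in> ?U" using pl by (auto simp: l1_weak_nbhd_def)
    ultimately obtain N where N: "N \<in> \<N>" "p a b \<in> N" "N \<subseteq> ?U" using network by blast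
    have "y a > 1/2 \<and> y b < -1/2" if "y \<in> N" for y
    proof -
      have "y \<in> l1 \<Gamma>" "\<bar>y a - p a b a\<bar> < 1/2" "\<bar>y b - p a b b\<bar> < 1/2"
        using that N(3) pl by (auto simp: l1_weak_nbhd_def l1_pair_coordinate)
      then show ?thesis using ab by (auto simp: p_def e_def abs_if split: if_splits)
    qed
    with N show ?thesis by blast
  qed
  have "\<forall>ab\<in>?E. \<exists>N. N \<in> \<N> \<and> p (fst ab) (snd ab) \<in> N \<and>
      (\<forall>y\<in>N. y (fst ab) > 1/2 \<and> y (snd ab) < -1/2)"
  proof
    fix ab assume "ab \<in> ?E"
    then show "\<exists>N. N \<in> \<N> \<and> p (fst ab) (snd ab) \<in> N \<and>
      (\<forall>y\<in>N. y (fst ab) > 1/2 \<and> y (snd ab) < -1/2)"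
      by (intro isolate) simp
  qed
  from bchoice[OF this] obtain g where "\<forall>ab\<in>?E. g ab \<in> \<N> \<and> p (fst ab) (snd ab) \<in> g ab \<and>
      (\<forall>y\<in>g ab. y (fst ab) > 1/2 \<and> y (snd ab) < -1/2)" ..
  note g = bspec[OF this, THEN conjunct1] bspec[OF this, THEN conjunct2, THEN conjunct1]
    bspec[OF this, THEN conjunct2, THEN conjunct2, THEN bspec]
  \<comment> \<open>Whichever layer \<open>g ab\<close> belongs to, it meets that layer's
    neighbourhood of 0, because the difference vector lies in all of the \<open>V n\<close>.\<close>
  have "g ` ?E \<subseteq> (\<Union>n. {N \<in> M n. N \<inter> V n \<noteq> {}})"
  proof
    fix N assume "N \<in> g ` ?E"
    then obtain ab where ab: "ab \<in> ?E" "N = g ab" by blast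
    then obtain n where "N \<in> M n" using g(1) M(2) by blast
    moreover have "p (fst ab) (snd ab) \<in> V n" using ab(1) pV[of "fst ab" "snd ab" n] by simp
    ultimately show "N \<in> (\<Union>n. {N \<in> M n. N \<inter> V n \<noteq> {}})" using g(2)[OF ab(1)] ab(2) by blast
  qed
  moreover have "countable (\<Union>n. {N \<in> M n. N \<inter> V n \<noteq> {}})"
    using V(3) by (auto intro: countable_finite)
  ultimately have "countable (g ` ?E)" by (rule countable_subset)
  \<comment> \<open>If \<open>s\<close> and \<open>t\<close> share a member, the vector of
    \<open>s\<close> exceeds 1/2 at the first index of \<open>t\<close> and is below -1/2 at the
    second; it takes such values only at its own two indices, in this order.\<close>
  moreover have "inj_on g ?E"
  proof (rule inj_onI)
    fix s t assume st: "s \<in> ?E" "t \<in> ?E" "g s = g t"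
    then have "p (fst s) (snd s) (fst t) > 1/2 \<and> p (fst s) (snd s) (snd t) < -1/2"
      using g(2)[OF st(1)] g(3)[OF st(2)] by simp
    then show "s = t"
      by (auto simp: p_def e_def indicator_def of_bool_def prod_eq_iff split: if_splits)
  qed
  ultimately have "countable ?E" by (rule countable_image_inj_on)
  moreover have "countable (\<Union>n. \<Phi> n)" using \<Phi>(1) by (auto intro: countable_finite)
  ultimately show ?thesis
    using lepoll_nat_sets_if_countable_ambiguity[of "\<Union>n. \<Phi> n" \<Gamma> "\<lambda>f a. f (e a)"] by blast
qed

section \<open>Weakly compact sets\<close>

text \<open>The finite intersection property, applied to closures. It supplies cluster points both
  along the finite subsets of \<Gamma> and along a sequence.\<close>

lemma compactin_closure_of_cluster:
  assumes "compactin X K" "\<And>n. n \<in> I \<Longrightarrow> S n \<subseteq> K"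
    and "\<And>J. finite J \<Longrightarrow> J \<subseteq> I \<Longrightarrow> K \<inter> (\<Inter>n\<in>J. S n) \<noteq> {}"
  obtains x where "x \<in> K" "\<And>n. n \<in> I \<Longrightarrow> x \<in> X closure_of S n"
proof -
  have "K \<inter> \<Inter>\<G> \<noteq> {}" if \<G>: "finite \<G>" "\<G> \<subseteq> (\<lambda>n. X closure_of S n) ` I" for \<G>
  proof -
    obtain J where J: "finite J" "J \<subseteq> I" "\<G> = (\<lambda>n. X closure_of S n) ` J"
      using finite_subset_image[OF \<G>] by blast
    have "S n \<subseteq> X closure_of S n" if "n \<in> J" for n
      using assms(1,2) J(2) that by (intro closure_of_subset)
        (meson compactin_subset_topspace order_trans subsetD)
    then show ?thesis using assms(3)[OF J(1,2)] unfolding J(3) by blast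
  qed
  then have "K \<inter> \<Inter>((\<lambda>n. X closure_of S n) ` I) \<noteq> {}"
    using assms(1) unfolding compactin_fip by (auto simp: closedin_closure_of)
  then show thesis using that by blast
qed

text \<open>Otherwise some \<open>x\<close> in \<open>K\<close> is a cluster point of elements with
  mass at least \<open>e\<close> off any given finite set. A sequence of such elements with nearly
  disjoint humps has a cluster point \<open>z\<close> that agrees with \<open>x\<close> wherever
  \<phi> is nonzero. The functional of \<phi> is then small at \<open>z\<close>, but uniformly large
  along the sequence.\<close>

lemma weakly_compact_uniform_tails:
  assumes K: "compactin (l1_weak_topology \<Gamma>) K" and e: "e > 0"
  obtains F where "finite F" "F \<subseteq> \<Gamma>" "\<And>x. x \<in> K \<Longrightarrow> l1_norm (\<Gamma> - F) x < e"
proof (rule ccontr)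
  let ?X = "l1_weak_topology \<Gamma>"
  assume "\<not> thesis"
  then have ex: "\<exists>x\<in>K. e \<le> l1_norm (\<Gamma> - F) x" if "finite F" "F \<subseteq> \<Gamma>" for F
    using that \<open>\<And>F. finite F \<Longrightarrow> F \<subseteq> \<Gamma> \<Longrightarrow> (\<And>x. x \<in> K \<Longrightarrow> l1_norm (\<Gamma> - F) x < e) \<Longrightarrow> thesis\<close>
    by (meson not_le)
  have Kl: "K \<subseteq> l1 \<Gamma>" using compactin_subset_topspace[OF K] by simp
  define A where "A F = {x \<in> K. e \<le> l1_norm (\<Gamma> - F) x}" for F
  obtain x where x: "x \<in> K" "\<And>F. F \<in> {F. finite F \<and> F \<subseteq> \<Gamma>} \<Longrightarrow> x \<in> ?X closure_of A F"
  proof (rule compactin_closure_of_cluster[OF K, of "{F. finite F \<and> F \<subseteq> \<Gamma>}" A])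
    show "A F \<subseteq> K" for F by (auto simp: A_def)
    fix J assume J: "finite J" "J \<subseteq> {F. finite F \<and> F \<subseteq> \<Gamma>}"
    then have "finite (\<Union>J)" "\<Union>J \<subseteq> \<Gamma>" by auto
    from ex[OF this] obtain y where y: "y \<in> K" "e \<le> l1_norm (\<Gamma> - \<Union>J) y" ..
    have "y \<in> A F" if "F \<in> J" for F
    proof -
      \<comment> \<open>Enlarging the finite set only shrinks the tail, so a single \<open>y\<close>
        serves all \<open>F\<close> in \<open>J\<close>.\<close>
      have "l1_norm (\<Gamma> - \<Union>J) y \<le> l1_norm (\<Gamma> - F) y"
        using y Kl that by (intro l1_norm_mono[of _ \<Gamma>]) auto
      then show ?thesis using y by (simp add: A_def)
    qed
    then show "K \<inter> (\<Inter>F\<in>J. A F) \<noteq> {}" using y by blast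
  qed blast
  then have xl: "x \<in> l1 \<Gamma>" using Kl by blast
  have step: "\<exists>y\<in>K. e \<le> l1_norm (\<Gamma> - F) y \<and> l1_norm F (\<lambda>i. y i - x i) < d"
    if F: "finite F" "F \<subseteq> \<Gamma>" and d: "d > 0" for F d
  proof -
    obtain V where V: "openin ?X V" "x \<in> V" "\<forall>y\<in>V. l1_norm F (\<lambda>i. y i - x i) < d"
      using l1_weak_nbhd_coordinates[OF xl F d] .
    then obtain y where "y \<in> A F" "y \<in> V"
      using x(2)[of F] F unfolding in_closure_of by blast
    with V(3) show ?thesis by (auto simp: A_def)
  qed
  \<comment> \<open>All later \<open>F n\<close> contain \<open>F0\<close>, so \<open>x\<close> has
    mass below \<open>e/10\<close> off each of them.\<close>
  obtain F0 where F0: "finite F0" "F0 \<subseteq> \<Gamma>" "l1_norm (\<Gamma> - F0) x < e/10"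
    using l1_tail[OF xl, of "e/10"] e by auto
  \<comment> \<open>\<open>y\<close> is close to \<open>x\<close> on \<open>F\<close>, has mass at
    least \<open>e\<close> off \<open>F\<close>, and nearly all of that mass lies in
    \<open>F' - F\<close>. The factor \<open>Suc n\<close> forces coordinatewise convergence to
    \<open>x\<close>.\<close>
  define R where "R n F F' y \<longleftrightarrow> y \<in> K \<and> e \<le> l1_norm (\<Gamma> - F) y \<and>
      l1_norm F (\<lambda>i. y i - x i) < e / 10 / real (Suc n) \<and> F \<subseteq> F' \<and> l1_norm (\<Gamma> - F') y < e / 10"
    for n F F' y
  have "\<exists>F. \<forall>n. (finite (F n) \<and> F n \<subseteq> \<Gamma> \<and> F0 \<subseteq> F n) \<and> (\<exists>y. R n (F n) (F (Suc n)) y)"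
  proof (rule dependent_nat_choice)
    show "\<exists>F. finite F \<and> F \<subseteq> \<Gamma> \<and> F0 \<subseteq> F" using F0 by blast
    fix F n assume F: "finite F \<and> F \<subseteq> \<Gamma> \<and> F0 \<subseteq> F"
    obtain y where y: "y \<in> K" "e \<le> l1_norm (\<Gamma> - F) y"
      "l1_norm F (\<lambda>i. y i - x i) < e / 10 / real (Suc n)"
      using step[of F "e / 10 / real (Suc n)"] F e by auto
    have yl: "y \<in> l1 \<Gamma>" using y Kl by blast
    obtain H where H: "finite H" "H \<subseteq> \<Gamma>" "l1_norm (\<Gamma> - H) y < e/10"
      using l1_tail[OF yl, of "e/10"] e by auto
    have "l1_norm (\<Gamma> - (F \<union> H)) y \<le> l1_norm (\<Gamma> - H) y"
      by (intro l1_norm_mono[OF yl]) auto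
    with y H F show "\<exists>F'. (finite F' \<and> F' \<subseteq> \<Gamma> \<and> F0 \<subseteq> F') \<and> (\<exists>y. R n F F' y)"
      by (intro exI[of _ "F \<union> H"] conjI exI[of _ y]) (auto simp: R_def)
  qed
  then obtain F where F: "\<And>n. finite (F n)" "\<And>n. F n \<subseteq> \<Gamma>" "\<And>n. F0 \<subseteq> F n"
    and exR: "\<And>n. \<exists>y. R n (F n) (F (Suc n)) y" by blast
  from choice[OF allI[OF exR]] obtain y where "\<forall>n. R n (F n) (F (Suc n)) (y n)" ..
  then have y: "y n \<in> K" "e \<le> l1_norm (\<Gamma> - F n) (y n)"
      "l1_norm (F n) (\<lambda>i. y n i - x i) < e / 10 / real (Suc n)" "F n \<subseteq> F (Suc n)"
      "l1_norm (\<Gamma> - F (Suc n)) (y n) < e / 10" for n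
    by (simp_all add: R_def)
  have yl: "y n \<in> l1 \<Gamma>" for n using y(1) Kl by blast
  have F_mono: "F m \<subseteq> F n" if "m \<le> n" for m n using lift_Suc_mono_le[of F, OF y(4) that] .
  \<comment> \<open>The gliding hump: \<open>\<phi>\<close> carries the signs of \<open>y n\<close> on the block \<open>F (Suc n) - F n\<close>.\<close>
  define \<phi> where "\<phi> i = (if i \<in> (\<Union>n. F n) - F 0
      then sgn (y ((LEAST m. i \<in> F m) - 1) i) else 0)" for i
  have \<phi>1: "\<bar>\<phi> i\<bar> \<le> 1" for i by (auto simp: \<phi>_def sgn_if)
  have \<phi>_dual: "l1_pair \<Gamma> \<phi> \<in> l1_dual \<Gamma>" by (rule l1_pair_in_dual[OF \<phi>1])
  have \<phi>_block: "\<phi> i * y n i = \<bar>y n i\<bar>" if "i \<in> F (Suc n) - F n" for i n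
  proof -
    \<comment> \<open>This explains the \<open>- 1\<close> in \<phi>: an index of the block from
      \<open>F n\<close> to \<open>F (Suc n)\<close> first appears at stage \<open>Suc n\<close> but
      belongs to \<open>y n\<close>.\<close>
    have "(LEAST m. i \<in> F m) = Suc n"
    proof (rule Least_equality)
      fix m assume "i \<in> F m"
      then show "Suc n \<le> m" using that F_mono[of m n] by (meson DiffD2 not_less_eq_eq subsetD)
    qed (use that in simp)
    moreover have "i \<notin> F 0" using that F_mono[of 0 n] by auto
    ultimately show ?thesis using that by (auto simp: \<phi>_def sgn_if)
  qed
  \<comment> \<open>The budget: the block carries at least \<open>e - e/10\<close>. Against it stand
    the remaining tail, the deviation from \<open>x\<close> on \<open>F n\<close>, and the mass of
    \<open>x\<close> off \<open>F0\<close>, each at most \<open>e/10\<close>.\<close>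
  have large: "6 * e / 10 \<le> l1_pair \<Gamma> \<phi> (y n)" for n
  proof -
    let ?G = "F (Suc n) - F n" and ?B = "(F n - F 0) \<union> (\<Gamma> - F (Suc n))"
    have "l1_norm ?G (y n) - l1_norm ?B (y n) \<le> l1_pair \<Gamma> \<phi> (y n)"
    proof (rule l1_pair_ge[OF yl \<phi>1])
      show "?G \<subseteq> \<Gamma>" "?B \<subseteq> \<Gamma>" using F(2) by auto
      show "?G \<inter> ?B = {}" by auto
      show "\<phi> i = 0" if "i \<in> \<Gamma> - (?G \<union> ?B)" for i using that by (auto simp: \<phi>_def)
    qed (rule \<phi>_block)
    moreover have "l1_norm (\<Gamma> - F n) (y n) = l1_norm ?G (y n) + l1_norm (\<Gamma> - F (Suc n)) (y n)"
    proof -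
      have "\<Gamma> - F n = ?G \<union> (\<Gamma> - F (Suc n))" using F(2) y(4)[of n] by blast
      then show ?thesis using l1_norm_Un[OF yl, of ?G "\<Gamma> - F (Suc n)"] F(2) by auto
    qed
    moreover have "l1_norm ?B (y n) = l1_norm (F n - F 0) (y n) + l1_norm (\<Gamma> - F (Suc n)) (y n)"
      using F(2) y(4)[of n] by (intro l1_norm_Un[OF yl]) auto
    moreover have "l1_norm (F n - F 0) (y n)
        \<le> l1_norm (F n - F 0) (\<lambda>i. y n i - x i) + l1_norm (F n - F 0) x"
      using F(2) by (intro l1_norm_le_diff[OF yl xl]) auto
    moreover have "l1_norm (F n - F 0) (\<lambda>i. y n i - x i) \<le> l1_norm (F n) (\<lambda>i. y n i - x i)"
      using F(2) by (intro l1_norm_mono[OF l1_diff[OF yl xl]]) auto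
    moreover have "l1_norm (F n - F 0) x \<le> l1_norm (\<Gamma> - F0) x"
      using F(2,3) by (intro l1_norm_mono[OF xl]) auto
    moreover have "e / 10 / real (Suc n) \<le> e / 10" using e by (simp add: divide_simps)
    ultimately show ?thesis using y(2,3,5)[of n] F0(3) by linarith
  qed
  obtain z where z: "z \<in> K" "\<And>n. n \<in> UNIV \<Longrightarrow> z \<in> ?X closure_of (y ` {n..})"
  proof (rule compactin_closure_of_cluster[OF K, of UNIV "\<lambda>n. y ` {n..}"])
    show "y ` {n..} \<subseteq> K" for n using y(1) by auto
    fix J :: "nat set" assume "finite J"
    \<comment> \<open>The sum of \<open>J\<close> is an index at least as large as every member of
      \<open>J\<close>.\<close>
    then have "y (\<Sum>J) \<in> K \<inter> (\<Inter>n\<in>J. y ` {n..})" using y(1) by (auto intro!: member_le_sum)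
    then show "K \<inter> (\<Inter>n\<in>J. y ` {n..}) \<noteq> {}" by blast
  qed blast
  then have zl: "z \<in> l1 \<Gamma>" using Kl by blast
  \<comment> \<open>Preimages of closed sets under functionals are weakly closed, so a closed
    condition that holds from stage \<open>n\<close> on passes to \<open>z\<close>.\<close>
  have z_closed: "f z \<in> C"
    if "f \<in> l1_dual \<Gamma>" "closed C" "\<And>m. m \<ge> n \<Longrightarrow> f (y m) \<in> C" for f C n
  proof -
    have "?X closure_of (y ` {n..}) \<subseteq> {w \<in> l1 \<Gamma>. f w \<in> C}"
      using that yl by (intro closure_of_minimal closedin_l1_weak_preimage) auto
    then show ?thesis using z(2)[of n] by auto
  qed
  have zx: "z i = x i" if i: "i \<in> F k" for i k
  proof -
    have "\<bar>z i - x i\<bar> \<le> e / 10 / real (Suc n)" if n: "n \<ge> k" for n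
    proof -
      have "l1_pair \<Gamma> (indicator {i}) z \<in> cball (x i) (e / 10 / real (Suc n))"
      proof (rule z_closed[OF l1_coordinate_in_dual closed_cball])
        fix m assume m: "m \<ge> n"
        then have "i \<in> F m" using i n F_mono[of k m] by auto
        then have "\<bar>y m i - x i\<bar> \<le> (\<Sum>j\<in>F m. \<bar>y m j - x j\<bar>)"
          using F(1) by (intro member_le_sum[of i _ "\<lambda>j. \<bar>y m j - x j\<bar>"]) auto
        also have "\<dots> < e / 10 / real (Suc m)" using y(3)[of m] F(1) by (simp add: l1_norm_def)
        also have "\<dots> \<le> e / 10 / real (Suc n)" using m e by (intro divide_left_mono) auto
        finally show "l1_pair \<Gamma> (indicator {i}) (y m) \<in> cball (x i) (e / 10 / real (Suc n))"
          using yl by (simp add: l1_pair_coordinate dist_real_def abs_minus_commute)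
      qed
      then show ?thesis using zl by (simp add: l1_pair_coordinate dist_real_def abs_minus_commute)
    qed
    then have "eventually (\<lambda>n. \<bar>z i - x i\<bar> \<le> e / 10 / real (Suc n)) sequentially"
      by (auto simp: eventually_sequentially)
    moreover have "(\<lambda>n. e / 10 / real (Suc n)) \<longlonglongrightarrow> 0"
      by (rule LIMSEQ_Suc[OF lim_const_over_n])
    ultimately have "\<bar>z i - x i\<bar> \<le> 0"
      by (intro tendsto_lowerbound[of _ 0 sequentially]) auto
    then show ?thesis by simp
  qed
  have "l1_pair \<Gamma> \<phi> z = l1_pair \<Gamma> \<phi> x"
    unfolding l1_pair_def by (intro infsum_cong) (auto simp: \<phi>_def zx)
  moreover have "\<bar>l1_pair \<Gamma> \<phi> x\<bar> \<le> l1_norm (\<Gamma> - F 0) x"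
    by (intro l1_pair_abs_le[OF xl \<phi>1]) (auto simp: \<phi>_def)
  moreover have "l1_norm (\<Gamma> - F 0) x \<le> l1_norm (\<Gamma> - F0) x"
    using F(3) by (intro l1_norm_mono[OF xl]) auto
  moreover have "l1_pair \<Gamma> \<phi> z \<in> {6 * e / 10..}"
    using large by (intro z_closed[OF \<phi>_dual, of _ 0]) auto
  ultimately show False using F0(3) e by simp
qed

text \<open>Hence the weak and the norm topology agree on weakly compact sets, which is how the Schur
  property enters.\<close>

lemma weakly_compact_norm_nbhd:
  assumes K: "compactin (l1_weak_topology \<Gamma>) K" and x: "x \<in> K" and r: "r > 0"
  obtains V where "openin (l1_weak_topology \<Gamma>) V" "x \<in> V"
    "\<forall>y\<in>V \<inter> K. l1_norm \<Gamma> (\<lambda>i. y i - x i) < r"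
proof -
  have Kl: "K \<subseteq> l1 \<Gamma>" using compactin_subset_topspace[OF K] by simp
  \<comment> \<open>One third for the coordinates in \<open>F\<close>, controlled weakly, and one
    for each of the tails of \<open>x\<close> and \<open>y\<close>.\<close>
  obtain F where F: "finite F" "F \<subseteq> \<Gamma>" "\<And>x. x \<in> K \<Longrightarrow> l1_norm (\<Gamma> - F) x < r/3"
    using weakly_compact_uniform_tails[OF K, of "r/3"] r by auto
  have xl: "x \<in> l1 \<Gamma>" using x Kl by auto
  obtain V where V: "openin (l1_weak_topology \<Gamma>) V" "x \<in> V"
    "\<forall>y\<in>V. l1_norm F (\<lambda>i. y i - x i) < r / 3"
    using l1_weak_nbhd_coordinates[OF xl F(1,2), of "r/3"] r by auto
  show thesis
  proof (rule that[OF V(1,2) ballI])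
    fix y assume "y \<in> V \<inter> K"
    then have y: "y \<in> V" "y \<in> K" by auto
    have l: "x \<in> l1 \<Gamma>" "y \<in> l1 \<Gamma>" using x y Kl by auto
    have "l1_norm F (\<lambda>i. y i - x i) < r / 3" using V(3) y(1) by blast
    moreover have "l1_norm \<Gamma> (\<lambda>i. y i - x i)
        = l1_norm F (\<lambda>i. y i - x i) + l1_norm (\<Gamma> - F) (\<lambda>i. y i - x i)"
      using l1_norm_Un[OF l1_diff[OF l(2,1)] F(2), of "\<Gamma> - F"] F(2) by (simp add: Un_absorb1)
    moreover have "l1_norm (\<Gamma> - F) (\<lambda>i. y i - x i) \<le> l1_norm (\<Gamma> - F) y + l1_norm (\<Gamma> - F) x"
      by (rule l1_norm_diff_le[OF l(2,1)]) auto
    ultimately show "l1_norm \<Gamma> (\<lambda>i. y i - x i) < r" using F(3)[OF x] F(3)[OF y(2)] by linarith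
  qed
qed

section \<open>The network\<close>

text \<open>A norm ball around a finitely supported \<open>x0\<close>, with the extra requirement that on the \<open>c\<close>-cell
  of a support point of \<open>x0\<close> the deviation from \<open>x0\<close> is below \<open>d\<close>. As \<open>d\<close> is small compared with the
  values of \<open>x0\<close>, the total mass of a cell detects weakly whether it contains a support point;
  a norm ball alone would not do, since its radius may exceed the values of \<open>x0\<close>.\<close>

definition cell_ball :: "'a set \<Rightarrow> ('a \<Rightarrow> nat) \<Rightarrow> real \<Rightarrow> real \<Rightarrow> ('a \<Rightarrow> real) \<Rightarrow> ('a \<Rightarrow> real) set" where
  "cell_ball \<Gamma> c d r x0 = {x \<in> l1 \<Gamma>. l1_norm \<Gamma> (\<lambda>i. x i - x0 i) < r \<and>
     (\<forall>i. x0 i \<noteq> 0 \<longrightarrow> l1_norm {j \<in> \<Gamma>. c j = c i} (\<lambda>i. x i - x0 i) < d)}"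

text \<open>\<open>Q\<close> prescribes the cell label and value of each support point but not its
  position within the cell. The centers for one \<open>Q\<close> may thus be very numerous, while
  finite patterns \<open>Q\<close> with rational values are countable in number.\<close>

definition cell_centers ::
    "'a set \<Rightarrow> ('a \<Rightarrow> nat) \<Rightarrow> real \<Rightarrow> (nat \<times> real) set \<Rightarrow> ('a \<Rightarrow> real) set" where
  "cell_centers \<Gamma> c d Q = {x0. {i. x0 i \<noteq> 0} \<subseteq> \<Gamma> \<and> finite {i. x0 i \<noteq> 0} \<and>
     inj_on c {i. x0 i \<noteq> 0} \<and> (\<lambda>i. (c i, x0 i)) ` {i. x0 i \<noteq> 0} = Q \<and>
     (\<forall>i. x0 i \<noteq> 0 \<longrightarrow> 4 * d < \<bar>x0 i\<bar>)}"

text \<open>Near \<open>y\<close>, every ball that is met has its center supported in a finite set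
  \<open>E\<close> carrying nearly all of \<open>y\<close>. Since the values of the center are
  prescribed by \<open>Q\<close>, finitely many centers remain.\<close>

lemma locally_finite_cell_balls:
  assumes "finite Q" "d > 0"
  shows "locally_finite_in (l1_weak_topology \<Gamma>) (cell_ball \<Gamma> c d r ` cell_centers \<Gamma> c d Q)"
  unfolding locally_finite_in_def
proof (intro conjI ballI)
  let ?X = "l1_weak_topology \<Gamma>"
  show "\<Union> (cell_ball \<Gamma> c d r ` cell_centers \<Gamma> c d Q) \<subseteq> topspace ?X"
    by (auto simp: cell_ball_def)
  fix y assume "y \<in> topspace ?X"
  then have y: "y \<in> l1 \<Gamma>" by simp
  obtain E where E: "finite E" "E \<subseteq> \<Gamma>" "l1_norm (\<Gamma> - E) y < d"
    using l1_tail[OF y assms(2)] .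
  \<comment> \<open>Cell sums with \<open>E\<close> removed: one functional per label in
    \<open>Q\<close>, hence finitely many, however many indices a cell contains.\<close>
  define \<phi> :: "nat \<Rightarrow> 'a \<Rightarrow> real" where "\<phi> s = indicator ({j. c j = s} - E)" for s
  have \<phi>1: "\<bar>\<phi> s i\<bar> \<le> 1" for s i by (simp add: \<phi>_def indicator_def)
  let ?\<Phi> = "(\<lambda>s. l1_pair \<Gamma> (\<phi> s)) ` fst ` Q"
  let ?V = "l1_weak_nbhd \<Gamma> ?\<Phi> y d"
  have open_V: "openin ?X ?V"
    using assms(1) by (intro openin_l1_weak_nbhd) (auto intro: l1_pair_in_dual[OF \<phi>1])
  have y_V: "y \<in> ?V" using y assms(2) by (auto simp: l1_weak_nbhd_def)
  have supp: "{i. x0 i \<noteq> 0} \<subseteq> E"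
    if x0: "x0 \<in> cell_centers \<Gamma> c d Q" and x: "x \<in> cell_ball \<Gamma> c d r x0" "x \<in> ?V" for x0 x
  proof (rule ccontr)
    assume "\<not> ?thesis"
    then obtain i where i: "x0 i \<noteq> 0" "i \<notin> E" by blast
    have i\<Gamma>: "i \<in> \<Gamma>" and inj: "inj_on c {i. x0 i \<noteq> 0}" and big: "4 * d < \<bar>x0 i\<bar>"
      and ciQ: "c i \<in> fst ` Q"
      using x0 i(1) by (force simp: cell_centers_def)+
    have x0l: "x0 \<in> l1 \<Gamma>" using x0 by (auto simp: cell_centers_def intro: l1_finite_support)
    have xl: "x \<in> l1 \<Gamma>" and near: "l1_norm {j \<in> \<Gamma>. c j = c i} (\<lambda>i. x i - x0 i) < d"
      using x(1) i(1) by (auto simp: cell_ball_def)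
    let ?f = "l1_pair \<Gamma> (\<phi> (c i))"
    have "\<bar>?f x - ?f y\<bar> < d"
      using x(2) ciQ by (auto simp: l1_weak_nbhd_def)
    moreover have "\<bar>?f y\<bar> \<le> l1_norm (\<Gamma> - E) y"
      by (intro l1_pair_abs_le[OF y \<phi>1]) (auto simp: \<phi>_def)
    moreover have "\<bar>?f (\<lambda>i. x i - x0 i)\<bar> \<le> l1_norm {j \<in> \<Gamma>. c j = c i} (\<lambda>i. x i - x0 i)"
      by (intro l1_pair_abs_le[OF l1_diff[OF xl x0l] \<phi>1]) (auto simp: \<phi>_def)
    moreover have "?f (\<lambda>i. x i - x0 i) = ?f x - ?f x0"
      by (rule l1_pair_diff[OF xl x0l \<phi>1])
    \<comment> \<open>\<open>i\<close> is the only support point in its cell, so the cell sum of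
      \<open>x0\<close> is one value above \<open>4 * d\<close>. The ball condition, the weak
      neighbourhood and the tail of \<open>y\<close> bound it by \<open>3 * d\<close>.\<close>
    moreover have "?f x0 = x0 i"
    proof -
      have "?f x0 = infsum x0 {i}"
        unfolding l1_pair_def
      proof (rule infsum_cong_neutral)
        fix j assume "j \<in> \<Gamma> - {i}"
        then show "\<phi> (c i) j * x0 j = 0"
          using inj i(1) by (auto simp: \<phi>_def indicator_def inj_on_def)
      qed (use i i\<Gamma> in \<open>auto simp: \<phi>_def\<close>)
      then show ?thesis by simp
    qed
    ultimately show False using big E(3) near by linarith
  qed
  have "finite {x0. {i. x0 i \<noteq> 0} \<subseteq> E \<and> x0 ` {i. x0 i \<noteq> 0} \<subseteq> snd ` Q}"
  proof (rule finite_subset)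
    show "finite {x0. \<forall>i. (i \<in> E \<longrightarrow> x0 i \<in> insert 0 (snd ` Q)) \<and> (i \<notin> E \<longrightarrow> x0 i = 0)}"
      using assms(1) E(1) by (intro finite_set_of_finite_funs) auto
  qed auto
  then have "finite (cell_ball \<Gamma> c d r ` {x0. {i. x0 i \<noteq> 0} \<subseteq> E \<and> x0 ` {i. x0 i \<noteq> 0} \<subseteq> snd ` Q})"
    by (rule finite_imageI)
  moreover have "{U \<in> cell_ball \<Gamma> c d r ` cell_centers \<Gamma> c d Q. U \<inter> ?V \<noteq> {}}
    \<subseteq> cell_ball \<Gamma> c d r ` {x0. {i. x0 i \<noteq> 0} \<subseteq> E \<and> x0 ` {i. x0 i \<noteq> 0} \<subseteq> snd ` Q}"
  proof
    fix U assume "U \<in> {U \<in> cell_ball \<Gamma> c d r ` cell_centers \<Gamma> c d Q. U \<inter> ?V \<noteq> {}}"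
    then obtain x0 x where x0: "x0 \<in> cell_centers \<Gamma> c d Q" and U: "U = cell_ball \<Gamma> c d r x0"
      and x: "x \<in> cell_ball \<Gamma> c d r x0" "x \<in> ?V" by blast
    have "{i. x0 i \<noteq> 0} \<subseteq> E" by (rule supp[OF x0 x])
    moreover have "x0 ` {i. x0 i \<noteq> 0} \<subseteq> snd ` Q" using x0 by (force simp: cell_centers_def)
    ultimately show "U \<in> cell_ball \<Gamma> c d r ` {x0. {i. x0 i \<noteq> 0} \<subseteq> E \<and> x0 ` {i. x0 i \<noteq> 0} \<subseteq> snd ` Q}"
      unfolding U by blast
  qed
  ultimately have "finite {U \<in> cell_ball \<Gamma> c d r ` cell_centers \<Gamma> c d Q. U \<inter> ?V \<noteq> {}}"
    by (rule rev_finite_subset)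
  with open_V y_V
  show "\<exists>V. openin ?X V \<and> y \<in> V \<and> finite {U \<in> cell_ball \<Gamma> c d r ` cell_centers \<Gamma> c d Q. U \<inter> V \<noteq> {}}"
    by blast
qed

lemma sigma_locally_finite_countable_UN:
  assumes "countable I" "\<And>i. i \<in> I \<Longrightarrow> locally_finite_in X (N i)"
  shows "sigma_locally_finite X (\<Union>i\<in>I. N i)"
proof (cases "I = {}")
  case True
  then show ?thesis
    unfolding sigma_locally_finite_def
    by (auto intro!: exI[of _ "\<lambda>_. {}"] finite_imp_locally_finite_in)
next
  case False
  then have "locally_finite_in X (N (from_nat_into I n))" for n
    using assms(2) from_nat_into by metis
  moreover have "(\<Union>i\<in>I. N i) = (\<Union>n. N (from_nat_into I n))"
    using range_from_nat_into[OF False assms(1)] by (metis image_image)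
  ultimately show ?thesis
    unfolding sigma_locally_finite_def by (intro exI[of _ "\<lambda>n. N (from_nat_into I n)"]) auto
qed

section \<open>Approximation by cell balls and assembly of the k-network\<close>

text \<open>The order of choices is essential: the radius \<open>r\<close>, the support
  \<open>F\<close>, then \<open>d\<close> below the values on \<open>F\<close>, then a larger finite
  \<open>G\<close> whose complement has mass small against \<open>d\<close>, and only then a level
  \<open>n\<close> whose cells separate \<open>G\<close>.\<close>

lemma exists_cell_ball:
  assumes z: "z \<in> l1 \<Gamma>" and "R > 0"
    and sep: "\<forall>i\<in>\<Gamma>. \<forall>j\<in>\<Gamma>. i \<noteq> j \<longrightarrow> eventually (\<lambda>n. c n i \<noteq> c n j) sequentially"
  obtains Q x0 n k \<rho> m where "finite Q" "Q \<subseteq> UNIV \<times> \<rat>"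
    "x0 \<in> cell_centers \<Gamma> (c n) (1 / real (Suc k)) Q" "\<rho> > 0"
    "\<forall>x\<in>l1 \<Gamma>. l1_norm \<Gamma> (\<lambda>i. x i - z i) < \<rho> \<longrightarrow>
       x \<in> cell_ball \<Gamma> (c n) (1 / real (Suc k)) (1 / real (Suc m)) x0"
    "\<forall>x\<in>cell_ball \<Gamma> (c n) (1 / real (Suc k)) (1 / real (Suc m)) x0.
       l1_norm \<Gamma> (\<lambda>i. x i - z i) < R"
proof -
  obtain m where m: "1 / real (Suc m) < R / 2"
    using reals_Archimedean[of "R/2"] \<open>R > 0\<close> by (auto simp: inverse_eq_divide)
  define r where "r = 1 / real (Suc m)"
  have r: "r > 0" "r < R / 2" using m by (auto simp: r_def)
  obtain F' where F': "finite F'" "F' \<subseteq> \<Gamma>" "l1_norm (\<Gamma> - F') z < r/4"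
    using l1_tail[OF z, of "r/4"] r by auto
  \<comment> \<open>Zeros of \<open>z\<close> are discarded so that the values on \<open>F\<close>
    stay away from 0.\<close>
  define F where "F = {i \<in> F'. z i \<noteq> 0}"
  have F: "finite F" "F \<subseteq> \<Gamma>" using F' by (auto simp: F_def)
  have tail: "l1_norm (\<Gamma> - F) z < r/4"
  proof -
    have "l1_norm (\<Gamma> - F) z = l1_norm (\<Gamma> - F') z"
      unfolding l1_norm_def by (intro infsum_cong_neutral) (auto simp: F_def)
    then show ?thesis using F' by simp
  qed
  have "eventually (\<lambda>k. \<forall>i\<in>F. 5 * (1 / real (Suc k)) < \<bar>z i\<bar>) sequentially"
  proof (intro eventually_ball_finite F(1) ballI)
    fix i assume "i \<in> F"
    then have "0 < \<bar>z i\<bar>" by (simp add: F_def)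
    moreover have "(\<lambda>k. 5 * (1 / real (Suc k))) \<longlonglongrightarrow> 5 * 0"
      by (intro tendsto_mult tendsto_const LIMSEQ_Suc[OF lim_const_over_n])
    ultimately show "eventually (\<lambda>k. 5 * (1 / real (Suc k)) < \<bar>z i\<bar>) sequentially"
      by (intro order_tendstoD) auto
  qed
  then obtain k where k: "\<forall>i\<in>F. 5 * (1 / real (Suc k)) < \<bar>z i\<bar>"
    by (auto simp: eventually_sequentially)
  define d where "d = 1 / real (Suc k)"
  have d: "d > 0" "\<And>i. i \<in> F \<Longrightarrow> 5 * d < \<bar>z i\<bar>" using k by (auto simp: d_def)
  obtain G' where G': "finite G'" "G' \<subseteq> \<Gamma>" "l1_norm (\<Gamma> - G') z < d/4"
    using l1_tail[OF z, of "d/4"] d by auto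
  define G where "G = G' \<union> F"
  have G: "finite G" "G \<subseteq> \<Gamma>" "F \<subseteq> G" using G' F by (auto simp: G_def)
  have G_tail: "l1_norm (\<Gamma> - G) z < d/4"
  proof -
    have "l1_norm (\<Gamma> - G) z \<le> l1_norm (\<Gamma> - G') z"
      by (intro l1_norm_mono[OF z]) (auto simp: G_def)
    then show ?thesis using G' by simp
  qed
  have "eventually (\<lambda>n. \<forall>i\<in>G. \<forall>j\<in>G. i \<noteq> j \<longrightarrow> c n i \<noteq> c n j) sequentially"
  proof (intro eventually_ball_finite G(1) ballI)
    fix i j assume "i \<in> G" "j \<in> G"
    then show "eventually (\<lambda>n. i \<noteq> j \<longrightarrow> c n i \<noteq> c n j) sequentially"
      using sep G(2) by (cases "i = j") (auto simp: subset_iff)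
  qed
  then obtain n where n: "inj_on (c n) G"
    by (auto simp: eventually_sequentially inj_on_def)
  \<comment> \<open>The first bound serves the cell condition, the second keeps the total error over
    \<open>F\<close> at most \<open>r/4\<close>.\<close>
  define \<eta> where "\<eta> = min (d / 4) (r / 4 / (1 + real (card F)))"
  have \<eta>: "\<eta> > 0" using d r by (auto simp: \<eta>_def intro!: divide_pos_pos)
  have "\<exists>q\<in>\<rat>. \<bar>z i - q\<bar> < \<eta>" for i
  proof -
    obtain q where "q \<in> \<rat>" "z i - \<eta> < q" "q < z i"
      using Rats_dense_in_real[of "z i - \<eta>" "z i"] \<eta> by auto
    then show ?thesis by (intro bexI[of _ q]) auto
  qed
  then obtain q where q: "\<And>i. q i \<in> \<rat>" "\<And>i. \<bar>z i - q i\<bar> < \<eta>" by metis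
  define x0 where "x0 i = (if i \<in> F then q i else 0)" for i
  have big: "4 * d < \<bar>x0 i\<bar>" if "i \<in> F" for i
  proof -
    have "\<bar>z i - q i\<bar> < d" using q(2)[of i] d(1) by (simp add: \<eta>_def)
    then show ?thesis using d(2)[OF that] that by (simp add: x0_def)
  qed
  have supp: "{i. x0 i \<noteq> 0} = F" using big d(1) by (force simp: x0_def)
  have x0l: "x0 \<in> l1 \<Gamma>" using supp F by (intro l1_finite_support) auto
  have norm1: "l1_norm \<Gamma> (\<lambda>i. z i - x0 i) < r / 2"
  proof -
    have "l1_norm F (\<lambda>i. z i - x0 i) = (\<Sum>i\<in>F. \<bar>z i - x0 i\<bar>)"
      using F by (simp add: l1_norm_def)
    also have "\<dots> \<le> (\<Sum>i\<in>F. r / 4 / (1 + real (card F)))"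
      using q(2) by (intro sum_mono) (auto simp: x0_def \<eta>_def less_imp_le)
    also have "\<dots> = real (card F) * (r / 4) / (1 + real (card F))" by simp
    also have "\<dots> \<le> r / 4" using r by (simp add: divide_simps)
    finally have 1: "l1_norm F (\<lambda>i. z i - x0 i) \<le> r / 4" .
    have 2: "l1_norm (\<Gamma> - F) (\<lambda>i. z i - x0 i) = l1_norm (\<Gamma> - F) z"
      unfolding l1_norm_def by (intro infsum_cong) (auto simp: x0_def)
    have "l1_norm \<Gamma> (\<lambda>i. z i - x0 i)
        = l1_norm F (\<lambda>i. z i - x0 i) + l1_norm (\<Gamma> - F) (\<lambda>i. z i - x0 i)"
      using l1_norm_Un[OF l1_diff[OF z x0l] F(2), of "\<Gamma> - F"] F(2) by (simp add: Un_absorb1)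
    then show ?thesis using 1 2 tail by linarith
  qed
  \<comment> \<open>The cell of \<open>i\<close> meets \<open>G\<close> only in \<open>i\<close>, so
    the rest of the cell has mass below \<open>d/4\<close>; the rounding error at \<open>i\<close>
    adds less than \<open>d/4\<close>.\<close>
  have norm2: "l1_norm {j \<in> \<Gamma>. c n j = c n i} (\<lambda>i. z i - x0 i) < d / 2" if i: "i \<in> F" for i
  proof -
    let ?C = "{j \<in> \<Gamma>. c n j = c n i}"
    have i\<Gamma>: "i \<in> \<Gamma>" using i F by auto
    have sub: "?C - {i} \<subseteq> \<Gamma> - G" using n i G(3) by (auto simp: inj_on_def)
    have "?C = {i} \<union> (?C - {i})" using i\<Gamma> by auto
    then have "l1_norm ?C (\<lambda>i. z i - x0 i)
        = l1_norm {i} (\<lambda>i. z i - x0 i) + l1_norm (?C - {i}) (\<lambda>i. z i - x0 i)"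
      using l1_norm_Un[OF l1_diff[OF z x0l], of "{i}" "?C - {i}"] i\<Gamma> by auto
    also have "l1_norm {i} (\<lambda>i. z i - x0 i) < d / 4"
      using q(2)[of i] i by (simp add: l1_norm_def x0_def \<eta>_def)
    also have "l1_norm (?C - {i}) (\<lambda>i. z i - x0 i) = l1_norm (?C - {i}) z"
      unfolding l1_norm_def using sub G(3) by (intro infsum_cong) (auto simp: x0_def)
    also have "\<dots> \<le> l1_norm (\<Gamma> - G) z"
      using sub by (intro l1_norm_mono[OF z]) auto
    finally show ?thesis using G_tail by linarith
  qed
  \<comment> \<open>\<open>z\<close> uses up less than half of each of the tolerances
    \<open>r\<close> and \<open>d\<close>; the other halves are left for \<open>x\<close>.\<close>
  have mem: "x \<in> cell_ball \<Gamma> (c n) d r x0"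
    if x: "x \<in> l1 \<Gamma>" "l1_norm \<Gamma> (\<lambda>i. x i - z i) < min (r/2) (d/2)" for x
    unfolding cell_ball_def
  proof (intro CollectI conjI allI impI x(1))
    show "l1_norm \<Gamma> (\<lambda>i. x i - x0 i) < r"
      using l1_norm_triangle[OF x(1) z x0l order_refl] norm1 x(2) by linarith
    fix i assume "x0 i \<noteq> 0"
    then have i: "i \<in> F" using supp by auto
    have "l1_norm {j \<in> \<Gamma>. c n j = c n i} (\<lambda>i. x i - z i) \<le> l1_norm \<Gamma> (\<lambda>i. x i - z i)"
      by (intro l1_norm_mono[OF l1_diff[OF x(1) z]]) auto
    then show "l1_norm {j \<in> \<Gamma>. c n j = c n i} (\<lambda>i. x i - x0 i) < d"
      using l1_norm_triangle[OF x(1) z x0l, of "{j \<in> \<Gamma>. c n j = c n i}"] norm2[OF i] x(2) by auto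
  qed
  have small: "l1_norm \<Gamma> (\<lambda>i. x i - z i) < R" if "x \<in> cell_ball \<Gamma> (c n) d r x0" for x
  proof -
    have x: "x \<in> l1 \<Gamma>" "l1_norm \<Gamma> (\<lambda>i. x i - x0 i) < r" using that by (auto simp: cell_ball_def)
    show ?thesis
      using l1_norm_triangle[OF x(1) x0l z order_refl] norm1 x(2) r
      by (simp add: l1_norm_minus_commute[of _ x0 z])
  qed
  show thesis
  proof (rule that[of "(\<lambda>i. (c n i, x0 i)) ` F" x0 n k "min (r/2) (d/2)" m, folded d_def r_def])
    show "x0 \<in> cell_centers \<Gamma> (c n) d ((\<lambda>i. (c n i, x0 i)) ` F)"
      unfolding cell_centers_def supp using F big supp inj_on_subset[OF n G(3)] by auto
    show "(\<lambda>i. (c n i, x0 i)) ` F \<subseteq> UNIV \<times> \<rat>" using q by (auto simp: x0_def)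
  qed (use F r d mem small in auto)
qed

text \<open>Each point of a compact \<open>K\<close> has a cell ball inside \<open>U\<close> that
  contains a norm ball around it. On \<open>K\<close> this norm ball contains a weak neighbourhood,
  and compactness selects finitely many.\<close>

lemma aleph_space_l1_weak_if_lepoll:
  assumes "\<Gamma> \<lesssim> (UNIV :: nat set set)"
  shows "aleph_space (l1_weak_topology \<Gamma>)"
proof -
  let ?X = "l1_weak_topology \<Gamma>"
  obtain h :: "'a \<Rightarrow> nat set" where h: "inj_on h \<Gamma>" using assms unfolding lepoll_def by blast
  \<comment> \<open>The cells of level \<open>n\<close> are the Cantor cylinders:
    \<open>c n i\<close> codes the first \<open>n\<close> binary digits of
    \<open>h i\<close>.\<close>
  define c where "c n i = set_encode (h i \<inter> {..<n})" for n i
  have "eventually (\<lambda>n. c n i \<noteq> c n j) sequentially"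
    if "i \<in> \<Gamma>" "j \<in> \<Gamma>" "i \<noteq> j" for i j
  proof -
    have "h i \<noteq> h j" using h that by (auto simp: inj_on_def)
    then obtain s where s: "s \<in> h i \<longleftrightarrow> s \<notin> h j" by blast
    have "c n i \<noteq> c n j" if "n > s" for n
    proof
      assume "c n i = c n j"
      then have "h i \<inter> {..<n} = h j \<inter> {..<n}" unfolding c_def by (simp add: set_encode_eq)
      then show False using s that by blast
    qed
    then show ?thesis unfolding eventually_sequentially by (intro exI[of _ "Suc s"]) auto
  qed
  then have sep: "\<forall>i\<in>\<Gamma>. \<forall>j\<in>\<Gamma>. i \<noteq> j \<longrightarrow> eventually (\<lambda>n. c n i \<noteq> c n j) sequentially"
    by blast
  \<comment> \<open>Level, pattern, and the indices of the two tolerances; rational values keep this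
    parameter set countable.\<close>
  define I :: "(nat \<times> (nat \<times> real) set \<times> nat \<times> nat) set" where
    "I = UNIV \<times> {Q. finite Q \<and> Q \<subseteq> UNIV \<times> \<rat>} \<times> UNIV \<times> UNIV"
  define N where "N = (\<lambda>(n, Q, k, m). cell_ball \<Gamma> (c n) (1 / real (Suc k)) (1 / real (Suc m)) `
      cell_centers \<Gamma> (c n) (1 / real (Suc k)) Q)"
  have "countable I"
    unfolding I_def by (intro countable_SIGMA countable_Collect_finite_subset) (auto simp: countable_rat)
  moreover have "locally_finite_in ?X (N i)" if "i \<in> I" for i
    using that by (auto simp: I_def N_def intro!: locally_finite_cell_balls simp del: of_nat_Suc)
  ultimately have "sigma_locally_finite ?X (\<Union>i\<in>I. N i)"
    by (rule sigma_locally_finite_countable_UN)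
  moreover have "k_network ?X (\<Union>i\<in>I. N i)"
    unfolding k_network_def
  proof (intro conjI allI impI)
    show "(\<Union>i\<in>I. N i) \<subseteq> Pow (topspace ?X)" by (auto simp: N_def cell_ball_def)
    fix K U assume "compactin ?X K \<and> openin ?X U \<and> K \<subseteq> U"
    then have K: "compactin ?X K" and U: "openin ?X U" and KU: "K \<subseteq> U" by auto
    have Kl: "K \<subseteq> l1 \<Gamma>" using compactin_subset_topspace[OF K] by simp
    have "\<exists>V B. openin ?X V \<and> z \<in> V \<and> V \<inter> K \<subseteq> B \<and> B \<in> (\<Union>i\<in>I. N i) \<and> B \<subseteq> U" if zK: "z \<in> K" for z
    proof -
      have zl: "z \<in> l1 \<Gamma>" using zK Kl by auto
      obtain R where R: "R > 0" "\<And>y. y \<in> l1 \<Gamma> \<Longrightarrow> l1_norm \<Gamma> (\<lambda>i. y i - z i) < R \<Longrightarrow> y \<in> U"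
        using l1_weak_open_imp_norm_open[OF U] zK KU by blast
      obtain Q x0 n k \<rho> m where *: "finite Q" "Q \<subseteq> UNIV \<times> \<rat>"
        "x0 \<in> cell_centers \<Gamma> (c n) (1 / real (Suc k)) Q" "\<rho> > 0"
        "\<forall>x\<in>l1 \<Gamma>. l1_norm \<Gamma> (\<lambda>i. x i - z i) < \<rho> \<longrightarrow>
           x \<in> cell_ball \<Gamma> (c n) (1 / real (Suc k)) (1 / real (Suc m)) x0"
        "\<forall>x\<in>cell_ball \<Gamma> (c n) (1 / real (Suc k)) (1 / real (Suc m)) x0.
           l1_norm \<Gamma> (\<lambda>i. x i - z i) < R"
        using exists_cell_ball[OF zl R(1) sep] .
      obtain V where V: "openin ?X V" "z \<in> V"
        "\<forall>y\<in>V \<inter> K. l1_norm \<Gamma> (\<lambda>i. y i - z i) < \<rho>"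
        using weakly_compact_norm_nbhd[OF K zK *(4)] .
      let ?B = "cell_ball \<Gamma> (c n) (1 / real (Suc k)) (1 / real (Suc m)) x0"
      have "?B \<in> N (n, Q, k, m)" unfolding N_def prod.case using *(3) by (rule imageI)
      moreover have "(n, Q, k, m) \<in> I" using *(1,2) by (simp add: I_def)
      ultimately have "?B \<in> (\<Union>i\<in>I. N i)" by (rule UN_I[rotated])
      moreover have "V \<inter> K \<subseteq> ?B" using V(3) *(5) Kl by blast
      moreover have "?B \<subseteq> U"
      proof
        fix x assume "x \<in> ?B"
        then show "x \<in> U" using *(6) R(2)[of x] by (simp add: cell_ball_def)
      qed
      ultimately show ?thesis using V(1,2) by blast
    qed
    then obtain V B where VB: "\<And>z. z \<in> K \<Longrightarrow> openin ?X (V z)" "\<And>z. z \<in> K \<Longrightarrow> z \<in> V z"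
      "\<And>z. z \<in> K \<Longrightarrow> V z \<inter> K \<subseteq> B z" "\<And>z. z \<in> K \<Longrightarrow> B z \<in> (\<Union>i\<in>I. N i)" "\<And>z. z \<in> K \<Longrightarrow> B z \<subseteq> U"
      by metis
    obtain \<G> where "finite \<G>" "\<G> \<subseteq> V ` K" "K \<subseteq> \<Union>\<G>"
      using compactinD[OF K, of "V ` K"] VB(1,2) by blast
    then obtain J where J: "finite J" "J \<subseteq> K" "K \<subseteq> \<Union>(V ` J)"
      by (metis finite_subset_image)
    show "\<exists>\<F>. finite \<F> \<and> \<F> \<subseteq> (\<Union>i\<in>I. N i) \<and> K \<subseteq> \<Union>\<F> \<and> \<Union>\<F> \<subseteq> U"
    proof (intro exI conjI)
      show "finite (B ` J)" using J(1) by simp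
      show "B ` J \<subseteq> (\<Union>i\<in>I. N i)" using J(2) VB(4) by blast
      show "K \<subseteq> \<Union>(B ` J)" using J(2,3) VB(3) by blast
      show "\<Union>(B ` J) \<subseteq> U" using J(2) VB(5) by blast
    qed
  qed
  ultimately show ?thesis unfolding aleph_space_def using regular_space_l1_weak by blast
qed

theorem theorem1p2:
  fixes \<Gamma> :: "'a set"
  shows "aleph_space (l1_weak_topology \<Gamma>) \<longleftrightarrow> \<Gamma> \<lesssim> (UNIV :: nat set set)"
proof
  assume "aleph_space (l1_weak_topology \<Gamma>)"
  then obtain \<N> where "sigma_locally_finite (l1_weak_topology \<Gamma>) \<N>"
    and k: "k_network (l1_weak_topology \<Gamma>) \<N>"
    unfolding aleph_space_def by blast
  then show "\<Gamma> \<lesssim> (UNIV :: nat set set)"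
    by (elim lepoll_if_sigma_locally_finite_network) (metis k_network_imp_network[OF k])
qed (rule aleph_space_l1_weak_if_lepoll)

end
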